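(* Let $w$ be a nonnegative continuous weight function on $[-1,1]$, let $\{p_l\}_{l\ge 0}$ be the orthonormal polynomials for $\langle f,g\rangle_w=\int_{-1}^1 f(x)\overline{g(x)}w(x)\,dx$ (with $\deg p_l=l$ and positive leading coefficient), satisfying the three-term recurrence $b_{l+1}p_{l+1}(x)=(x-a_l)p_l(x)-b_lp_{l-1}(x)$, $l\ge 0$, $p_{-1}=0$, $p_0=1/b_0$, with $a_l\in\mathbb{R}$, $b_l>0$. Let $0\le m\le n$ be integers and let $\mathcal{R}(x)=p_m(x)+\sum_{l=0}^{m-1}e_lp_l(x)$ with $e_l\in\mathbb{C}$. Put $\gamma_{\mathcal{R}}:=\varepsilon(\mathcal{R})-a_m$ and $\delta_{\mathcal{R}}:=\|\mathcal{R}\|_w^2$. Let $\lambda_{n+1}$, $\lambda^m_{n-m+1}$ and $\lambda^{\mathcal{R}}_{n-m+1}$ denote the largest zero in $[-1,1]$ of $p_{n+1}(x)$, of $p_{n-m+1}(x,m)$ and of $p_{n-m+1}(x,m,\gamma_{\mathcal{R}},\delta_{\mathcal{R}})$, respectively. Then: (1) The maximizers of $\varepsilon$ over $\mathbb{S}_n$ are exactly the polynomials $\mathcal{P}_n(x)=\kappa_1\sum_{l=0}^n p_l(\lambda_{n+1})p_l(x)$, where $\kappa_1\in\mathbb{C}$ is such that $\|\mathcal{P}_n\|_w=1$ (so $\mathcal{P}_n$ is unique up to multiplication by a complex scalar of absolute value one), and $\max_{P\in\mathbb{S}_n}\varepsilon(P)=\lambda_{n+1}$. (2) The maximizers of $\varepsilon$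 over $\mathbb{S}_n^m$ are exactly the polynomials $\mathcal{P}_n^m(x)=\kappa_2\sum_{l=m}^n p_{l-m}(\lambda^m_{n-m+1},m)\,p_l(x)$, where $\kappa_2\in\mathbb{C}$ is such that $\|\mathcal{P}^m_n\|_w=1$ (unique up to a unimodular scalar), and $\max_{P\in\mathbb{S}^m_n}\varepsilon(P)=\lambda^m_{n-m+1}$. (3) The maximizers of $\varepsilon$ over $\mathbb{S}_n^{\mathcal{R}}$ are exactly the polynomials $\mathcal{P}_n^{\mathcal{R}}(x)=\kappa_3\big(\mathcal{R}(x)+\sum_{l=m+1}^n p_{l-m}(\lambda^{\mathcal{R}}_{n-m+1},m,\gamma_{\mathcal{R}},\delta_{\mathcal{R}})\,p_l(x)\big)$, where $\kappa_3\in\mathbb{C}$ is such that $\|\mathcal{P}^{\mathcal{R}}_n\|_w=1$ (unique up to a unimodular scalar), and $\max_{P\in\mathbb{S}^{\mathcal{R}}_n}\varepsilon(P)=\lambda^{\mathcal{R}}_{n-m+1}$.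
   Context: For $f\in L^2([-1,1],w)$, $\varepsilon(f):=\int_{-1}^1 x|f(x)|^2w(x)\,dx$ and $\|f\|_w^2=\langle f,f\rangle_w$. Polynomial spaces: $\Pi_n=\{\sum_{l=0}^n c_lp_l: c_l\in\mathbb{C}\}$, $\Pi_n^m=\{\sum_{l=m}^n c_lp_l: c_l\in\mathbb{C}\}$, $\Pi_n^{\mathcal{R}}=\{c_m\mathcal{R}+\sum_{l=m+1}^n c_lp_l: c_l\in\mathbb{C}\}$; their unit spheres are $\mathbb{S}_n,\mathbb{S}_n^m,\mathbb{S}_n^{\mathcal{R}}$ (elements with $\|P\|_w=1$). Associated polynomials $p_l(x,m)$: $p_{-1}(x,m)=0$, $p_0(x,m)=1$, $b_{m+l+1}p_{l+1}(x,m)=(x-a_{m+l})p_l(x,m)-b_{m+l}p_{l-1}(x,m)$ for $l\ge0$. Scaled co-recursive associated polynomials, for $\gamma\in\mathbb{R}$, $\delta\ge 0$: $p_0(x,m,\gamma,\delta)=1$, $p_1(x,m,\gamma,\delta)=(\delta x-a_m-\gamma)/b_{m+1}$, and $b_{m+l+1}p_{l+1}(x,m,\gamma,\delta)=(x-a_{m+l})p_l(x,m,\gamma,\delta)-b_{m+l}p_{l-1}(x,m,\gamma,\delta)$ for $l\ge1$. *)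

theory Defs
  imports "HOL-Analysis.Analysis" "HOL-Computational_Algebra.Polynomial"
begin

definition wnorm2 :: "(real \<Rightarrow> real) \<Rightarrow> (real \<Rightarrow> complex) \<Rightarrow> real" where
  "wnorm2 w f = integral {-1..1} (\<lambda>x. (cmod (f x))^2 * w x)"

definition eps :: "(real \<Rightarrow> real) \<Rightarrow> (real \<Rightarrow> complex) \<Rightarrow> real" where
  "eps w f = integral {-1..1} (\<lambda>x. x * (cmod (f x))^2 * w x)"

definition Pi_n :: "(nat \<Rightarrow> real poly) \<Rightarrow> nat \<Rightarrow> (real \<Rightarrow> complex) set" where
  "Pi_n p n = {P. \<exists>c::nat \<Rightarrow> complex.
      P = (\<lambda>x. \<Sum>l\<le>n. c l * complex_of_real (poly (p l) x))}"

definition Pi_nm :: "(nat \<Rightarrow> real poly) \<Rightarrow> nat \<Rightarrow> nat \<Rightarrow> (real \<Rightarrow> complex) set" where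
  "Pi_nm p m n = {P. \<exists>c::nat \<Rightarrow> complex.
      P = (\<lambda>x. \<Sum>l\<in>{m..n}. c l * complex_of_real (poly (p l) x))}"

definition Pi_nR :: "(nat \<Rightarrow> real poly) \<Rightarrow> (real \<Rightarrow> complex) \<Rightarrow> nat \<Rightarrow> nat \<Rightarrow> (real \<Rightarrow> complex) set" where
  "Pi_nR p R m n = {P. \<exists>c::nat \<Rightarrow> complex.
      P = (\<lambda>x. c m * R x + (\<Sum>l\<in>{m+1..n}. c l * complex_of_real (poly (p l) x)))}"

definition unit_sphere_w :: "(real \<Rightarrow> real) \<Rightarrow> (real \<Rightarrow> complex) set \<Rightarrow> (real \<Rightarrow> complex) set" where
  "unit_sphere_w w S = {P \<in> S. sqrt (wnorm2 w P) = 1}"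

definition maximizers :: "(real \<Rightarrow> real) \<Rightarrow> (real \<Rightarrow> complex) set \<Rightarrow> (real \<Rightarrow> complex) set" where
  "maximizers w S = {P \<in> S. \<forall>Q\<in>S. eps w Q \<le> eps w P}"

fun corec_assoc :: "(nat \<Rightarrow> real) \<Rightarrow> (nat \<Rightarrow> real) \<Rightarrow> nat \<Rightarrow> real \<Rightarrow> real \<Rightarrow> nat \<Rightarrow> real \<Rightarrow> real" where
  "corec_assoc a b m \<gamma> \<delta> 0 x = 1"
| "corec_assoc a b m \<gamma> \<delta> (Suc 0) x = (\<delta> * x - a m - \<gamma>) / b (m + 1)"
| "corec_assoc a b m \<gamma> \<delta> (Suc (Suc l)) x =
     ((x - a (m + l + 1)) * corec_assoc a b m \<gamma> \<delta> (Suc l) x - b (m + l + 1) * corec_assoc a b m \<gamma> \<delta> l x)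
       / b (m + l + 2)"

fun assoc_poly :: "(nat \<Rightarrow> real) \<Rightarrow> (nat \<Rightarrow> real) \<Rightarrow> nat \<Rightarrow> nat \<Rightarrow> real \<Rightarrow> real" where
  "assoc_poly a b m 0 x = 1"
| "assoc_poly a b m (Suc 0) x = (x - a m) / b (m + 1)"
| "assoc_poly a b m (Suc (Suc l)) x =
     ((x - a (m + l + 1)) * assoc_poly a b m (Suc l) x - b (m + l + 1) * assoc_poly a b m l x)
       / b (m + l + 2)"

definition largest_zero :: "(real \<Rightarrow> real) \<Rightarrow> real" where
  "largest_zero f = Max {x \<in> {-1..1}. f x = 0}"

end

theory Submission
  imports Defs
begin

text \<open>
  Let \<open>q\<^sub>j\<close> denote the scaled co-recursive associated polynomials. If an element of
  \<open>\<Pi>\<^sub>n\<^sup>R\<close> has coefficients \<open>u\<^sub>0\<close> of \<open>R\<close> and \<open>q\<^sub>j(\<mu>) u\<^sub>j\<close> of \<open>p\<^bsub>m+j\<^esub>\<close>, then the recurrence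
  turns \<open>\<mu> \<parallel>P\<parallel>\<^sup>2 - \<epsilon>(P)\<close> into the weighted sum of squares
  \<open>\<Sum>\<^sub>j b\<^bsub>m+j+1\<^esub> q\<^sub>j(\<mu>) q\<^bsub>j+1\<^esub>(\<mu>) \<bar>u\<^sub>j - u\<^bsub>j+1\<^esub>\<bar>\<^sup>2\<close> plus a boundary term with
  factor \<open>q\<^bsub>n-m+1\<^esub>(\<mu>)\<close>. At the largest zero of \<open>q\<^bsub>n-m+1\<^esub>\<close> the boundary term vanishes and all
  weights are positive, so \<open>\<epsilon>(P) \<le> \<mu> \<parallel>P\<parallel>\<^sup>2\<close> with equality exactly for constant \<open>u\<close>. This zero
  lies in \<open>[-1,1]\<close> because it is a quotient \<open>\<epsilon>(P) / \<parallel>P\<parallel>\<^sup>2\<close>. The space \<open>\<Pi>\<^sub>n\<^sup>m\<close> is the case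
  \<open>R = p\<^sub>m\<close>, and \<open>\<Pi>\<^sub>n\<close> is the case \<open>m = 0\<close> of the latter.
\<close>

section \<open>Scaled co-recursive associated polynomials: growth and largest zeros\<close>

lemma corec_assoc_is_poly: "\<exists>Q. \<forall>x. poly Q x = corec_assoc a b m \<gamma> \<delta> l x"
proof (induction l rule: less_induct)
  case (less l)
  consider "l = 0" | "l = Suc 0" | k where "l = Suc (Suc k)"
    by (metis not0_implies_Suc)
  then show ?case
  proof cases
    case 1
    then show ?thesis by (intro exI[of _ 1]) simp
  next
    case 2
    then show ?thesis
      by (intro exI[of _ "[:- (a m + \<gamma>) / b (m + 1), \<delta> / b (m + 1):]"])
        (simp add: diff_divide_distrib add_divide_distrib)
  next
    case 3
    obtain P Q where "\<forall>x. poly P x = corec_assoc a b m \<gamma> \<delta> k x"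
      and "\<forall>x. poly Q x = corec_assoc a b m \<gamma> \<delta> (Suc k) x"
      using less 3 by (metis lessI less_SucI)
    then show ?thesis using 3
      by (intro exI[of _ "smult (1 / b (m + k + 2))
            ([:- a (m + k + 1), 1:] * Q - smult (b (m + k + 1)) P)"])
        (simp add: left_diff_distrib)
  qed
qed

lemma continuous_on_corec_assoc: "continuous_on S (corec_assoc a b m \<gamma> \<delta> l)"
proof -
  obtain Q where "\<forall>x. poly Q x = corec_assoc a b m \<gamma> \<delta> l x"
    using corec_assoc_is_poly by blast
  then have "corec_assoc a b m \<gamma> \<delta> l = poly Q" by (simp add: fun_eq_iff)
  then show ?thesis by (auto intro: continuous_intros)
qed

text \<open>Gives positivity near infinity without computing leading coefficients. Monotonicity in
  the degree is carried through the induction because it lets the subtracted lower polynomial be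
  absorbed into the upper one, leaving the factor \<open>x - a (m + l + 1) - b (m + l + 1)\<close>,
  which eventually exceeds \<open>b (m + l + 2)\<close>.\<close>

lemma corec_assoc_eventually_ge:
  assumes b: "\<forall>l. b l > 0" and \<delta>: "\<delta> > 0"
  shows "eventually (\<lambda>x. 0 < corec_assoc a b m \<gamma> \<delta> l x \<and>
           corec_assoc a b m \<gamma> \<delta> l x \<le> corec_assoc a b m \<gamma> \<delta> (Suc l) x) at_top"
proof (induction l)
  case 0
  \<comment> \<open>The threshold is the point where the polynomial of degree one takes the value
    1.\<close>
  show ?case using eventually_ge_at_top[of "(b (m + 1) + a m + \<gamma>) / \<delta>"]
    by eventually_elim (use b \<delta> in \<open>simp add: field_simps\<close>)
next
  case (Suc l)
  show ?case
    using Suc eventually_ge_at_top[of "a (m + l + 1) + b (m + l + 1) + b (m + l + 2)"]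
  proof eventually_elim
    case (elim x)
    let ?q = "\<lambda>l. corec_assoc a b m \<gamma> \<delta> l x"
    have "b (m + l + 1) * ?q l \<le> b (m + l + 1) * ?q (Suc l)"
      using elim b by (simp add: less_imp_le)
    moreover have "b (m + l + 2) * ?q (Suc l)
        \<le> (x - a (m + l + 1) - b (m + l + 1)) * ?q (Suc l)"
      by (rule mult_right_mono) (use elim in auto)
    ultimately have "b (m + l + 2) * ?q (Suc l)
        \<le> (x - a (m + l + 1)) * ?q (Suc l) - b (m + l + 1) * ?q l"
      by (simp add: algebra_simps)
    then have "?q (Suc l) \<le> ?q (Suc (Suc l))"
      using b by (simp add: pos_le_divide_eq mult.commute)
    with elim show ?case by simp
  qed
qed

lemma finite_zeros_corec_assoc:
  assumes b: "\<forall>l. b l > 0" and \<delta>: "\<delta> > 0"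
  shows "finite {x. corec_assoc a b m \<gamma> \<delta> l x = 0}"
proof -
  obtain Q where Q: "\<forall>x. poly Q x = corec_assoc a b m \<gamma> \<delta> l x"
    using corec_assoc_is_poly by blast
  obtain X where "0 < corec_assoc a b m \<gamma> \<delta> l X"
    using eventually_happens[OF corec_assoc_eventually_ge[OF assms, of a m \<gamma> l]] by auto
  with Q have "Q \<noteq> 0" by (metis less_irrefl poly_0)
  then show ?thesis using poly_roots_finite[of Q] Q by simp
qed

text \<open>At the largest zero of one polynomial the recurrence makes the next one negative, so
  largest zeros increase with the degree and all lower polynomials are positive there.\<close>

lemma corec_assoc_largest_real_zero:
  assumes b: "\<forall>l. b l > 0" and \<delta>: "\<delta> > 0"
  shows "\<exists>\<mu>. corec_assoc a b m \<gamma> \<delta> (Suc l) \<mu> = 0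
          \<and> (\<forall>j\<le>l. \<forall>x\<ge>\<mu>. corec_assoc a b m \<gamma> \<delta> j x > 0)
          \<and> (\<forall>x>\<mu>. corec_assoc a b m \<gamma> \<delta> (Suc l) x > 0)"
proof (induction l)
  case 0
  show ?case using b \<delta>
    by (intro exI[of _ "(a m + \<gamma>) / \<delta>"])
      (auto simp: field_simps)
next
  case (Suc l)
  let ?q = "corec_assoc a b m \<gamma> \<delta>"
  obtain \<mu> where \<mu>: "?q (Suc l) \<mu> = 0" "\<forall>j\<le>l. \<forall>x\<ge>\<mu>. ?q j x > 0" "\<forall>x>\<mu>. ?q (Suc l) x > 0"
    using Suc by blast
  have large: "\<exists>X>y. ?q (Suc (Suc l)) X > 0" for y
    using eventually_happens[OF eventually_conj[OF eventually_gt_at_top[of y]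
        corec_assoc_eventually_ge[OF assms, of a m \<gamma> "Suc (Suc l)"]]] by auto
  have zero_above: "\<exists>z\<ge>y. ?q (Suc (Suc l)) z = 0" if "?q (Suc (Suc l)) y \<le> 0" for y
  proof -
    obtain X where "X > y" "?q (Suc (Suc l)) X > 0" using large by blast
    then show ?thesis
      using IVT'[of "?q (Suc (Suc l))" y 0 X] that continuous_on_corec_assoc
      by (meson less_imp_le)
  qed
  have "0 < b (m + l + 1) * ?q l \<mu> / b (m + l + 2)"
    using \<mu>(2) b by simp
  then have neg: "?q (Suc (Suc l)) \<mu> < 0"
    using \<mu>(1) by simp
  define Z where "Z = {x. \<mu> \<le> x \<and> ?q (Suc (Suc l)) x = 0}"
  have fin: "finite Z" unfolding Z_def
    by (rule finite_subset[OF _ finite_zeros_corec_assoc[OF assms, of a m \<gamma> "Suc (Suc l)"]]) blast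
  have ne: "Z \<noteq> {}" using zero_above[of \<mu>] neg unfolding Z_def by fastforce
  define \<nu> where "\<nu> = Max Z"
  have \<nu>: "\<nu> \<in> Z" unfolding \<nu>_def using fin ne by simp
  then have "\<nu> > \<mu>" using neg unfolding Z_def by (smt (verit) mem_Collect_eq)
  \<comment> \<open>A nonpositive value beyond \<open>\<nu>\<close> would force a zero still further
    right, against the maximality of \<open>\<nu>\<close>.\<close>
  have "?q (Suc (Suc l)) x > 0" if "x > \<nu>" for x
  proof (rule ccontr)
    assume "\<not> ?thesis"
    then obtain z where "z \<ge> x" "?q (Suc (Suc l)) z = 0" using zero_above[of x] by auto
    then have "z \<in> Z" using that \<open>\<nu> > \<mu>\<close> by (simp add: Z_def)
    then have "z \<le> \<nu>" unfolding \<nu>_def using fin by simp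
    then show False using \<open>z \<ge> x\<close> that by simp
  qed
  \<comment> \<open>Lower degrees are positive from \<open>\<mu>\<close> on, but degree
    \<open>Suc l\<close> only strictly beyond it; this is why \<open>\<nu> > \<mu>\<close> has to be
    strict.\<close>
  moreover have "?q j x > 0" if "j \<le> Suc l" "x \<ge> \<nu>" for j x
    using that \<mu> \<open>\<nu> > \<mu>\<close> by (cases "j = Suc l") auto
  ultimately show ?case using \<nu> unfolding Z_def by blast
qed

section \<open>The Jacobi form and its decomposition into squares\<close>

text \<open>The Hermitian form of the tridiagonal Jacobi matrix with diagonal \<open>a\<close> and
  off-diagonal \<open>b 1\<close>, ..., \<open>b n\<close>; each conjugate pair of off-diagonal
  terms is merged into twice a real part.\<close>

definition jacobi_form :: "(nat \<Rightarrow> real) \<Rightarrow> (nat \<Rightarrow> real) \<Rightarrow> nat \<Rightarrow> (nat \<Rightarrow> complex) \<Rightarrow> real" where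
  "jacobi_form a b n C = (\<Sum>l\<le>n. a l * (cmod (C l))\<^sup>2)
     + 2 * (\<Sum>l<n. b (l + 1) * Re (C l * cnj (C (Suc l))))"

lemma cmod_diff_sq: "(cmod (u - v))\<^sup>2 = (cmod u)\<^sup>2 + (cmod v)\<^sup>2 - 2 * Re (u * cnj v)"
  by (simp only: cmod_power2) (simp add: power2_eq_square algebra_simps)

text \<open>Induction on \<open>k\<close>: the old boundary term and the new cross term combine into
  \<open>b (m + k + 1) * q k * q (Suc k)\<close> times \<open>(cmod (u k - u (Suc k)))\<^sup>2 -
  (cmod (u (Suc k)))\<^sup>2\<close>. By the recurrence, what then multiplies
  \<open>(cmod (u (Suc k)))\<^sup>2\<close> is the next boundary factor.\<close>

lemma jacobi_form_sum_of_squares: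
  fixes E u :: "nat \<Rightarrow> complex" and a b :: "nat \<Rightarrow> real" and \<mu> :: real
  assumes b: "\<forall>l. b l > 0" and Em: "E m = 1"
  defines "q \<equiv> \<lambda>j. corec_assoc a b m (jacobi_form a b m E - a m) (\<Sum>l\<le>m. (cmod (E l))\<^sup>2) j \<mu>"
  defines "C \<equiv> \<lambda>l. if l \<le> m then u 0 * E l else complex_of_real (q (l - m)) * u (l - m)"
  shows "\<mu> * (\<Sum>l\<le>m + k. (cmod (C l))\<^sup>2) - jacobi_form a b (m + k) C
    = (\<Sum>j<k. b (m + j + 1) * q j * q (Suc j) * (cmod (u j - u (Suc j)))\<^sup>2)
      + b (m + k + 1) * q (Suc k) * q k * (cmod (u k))\<^sup>2"
proof (induction k)
  case 0
  have "(\<Sum>l\<le>m. (cmod (C l))\<^sup>2) = (cmod (u 0))\<^sup>2 * (\<Sum>l\<le>m. (cmod (E l))\<^sup>2)"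
    by (simp add: C_def norm_mult power_mult_distrib sum_distrib_left)
  moreover have "jacobi_form a b m C = (cmod (u 0))\<^sup>2 * jacobi_form a b m E"
  proof -
    have *: "Re (u 0 * x * cnj (u 0 * y)) = (cmod (u 0))\<^sup>2 * Re (x * cnj y)" for x y
      by (simp only: cmod_power2) (simp add: power2_eq_square algebra_simps)
    have "(\<Sum>l<m. b (l + 1) * Re (C l * cnj (C (Suc l))))
        = (\<Sum>l<m. (cmod (u 0))\<^sup>2 * (b (l + 1) * Re (E l * cnj (E (Suc l)))))"
      by (intro sum.cong refl) (simp add: C_def * del: complex_cnj_mult times_complex.sel)
    then show ?thesis
      by (simp add: jacobi_form_def C_def norm_mult power_mult_distrib sum_distrib_left
          algebra_simps)
  qed
  \<comment> \<open>The shift and the scaling in \<open>q\<close> are chosen for this equation: the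
    block of indices up to \<open>m\<close> contributes exactly the numerator of the polynomial of
    degree one.\<close>
  moreover have "\<mu> * (\<Sum>l\<le>m. (cmod (E l))\<^sup>2) - jacobi_form a b m E = b (m + 1) * q (Suc 0)"
    using b[rule_format, of "m + 1"] by (simp add: q_def)
  moreover have "q 0 = 1" by (simp add: q_def)
  ultimately have "\<mu> * (\<Sum>l\<le>m. (cmod (C l))\<^sup>2) - jacobi_form a b m C
      = (cmod (u 0))\<^sup>2 * (b (m + 1) * q (Suc 0))"
    by (simp only: mult.left_commute[of \<mu>] right_diff_distrib[symmetric])
  with \<open>q 0 = 1\<close> show ?case by simp
next
  case (Suc k)
  \<comment> \<open>For \<open>k = 0\<close> the coefficient comes from the other branch of
    \<open>C\<close>; \<open>E m = 1\<close> and \<open>q 0 = 1\<close> make the two branches fit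
    together.\<close>
  have Ck: "C (m + k) = q k * u k" using Em by (cases k) (auto simp: C_def q_def)
  have CSk: "C (Suc (m + k)) = q (Suc k) * u (Suc k)" by (simp add: C_def Suc_diff_le)
  have rec: "b (m + k + 2) * q (Suc (Suc k))
      = (\<mu> - a (m + k + 1)) * q (Suc k) - b (m + k + 1) * q k"
    using b[rule_format, of "m + k + 2"] by (simp add: q_def)
  have "b (m + Suc k + 1) * q (Suc (Suc k)) * q (Suc k) * (cmod (u (Suc k)))\<^sup>2
      = (b (m + k + 2) * q (Suc (Suc k))) * (q (Suc k) * (cmod (u (Suc k)))\<^sup>2)"
    by simp
  also have "\<dots> = ((\<mu> - a (m + k + 1)) * q (Suc k) - b (m + k + 1) * q k)
                  * (q (Suc k) * (cmod (u (Suc k)))\<^sup>2)"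
    by (simp only: rec)
  finally have last: "b (m + Suc k + 1) * q (Suc (Suc k)) * q (Suc k) * (cmod (u (Suc k)))\<^sup>2 = \<dots>" .
  have cross: "Re (C (m + k) * cnj (C (Suc (m + k)))) = q k * q (Suc k) * Re (u k * cnj (u (Suc k)))"
    unfolding Ck CSk by (simp add: algebra_simps)
  have sq: "(cmod (C (Suc (m + k))))\<^sup>2 = (q (Suc k))\<^sup>2 * (cmod (u (Suc k)))\<^sup>2"
    by (simp add: CSk norm_mult power_mult_distrib)
  have "jacobi_form a b (m + Suc k) C = jacobi_form a b (m + k) C
      + a (m + k + 1) * ((q (Suc k))\<^sup>2 * (cmod (u (Suc k)))\<^sup>2)
      + 2 * (b (m + k + 1) * (q k * q (Suc k) * Re (u k * cnj (u (Suc k)))))"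
    unfolding jacobi_form_def add_Suc_right sum.atMost_Suc sum.lessThan_Suc sq cross by simp
  then show ?case
    using Suc.IH unfolding last
    unfolding add_Suc_right sum.atMost_Suc sum.lessThan_Suc sq cmod_diff_sq
    by (simp add: algebra_simps power2_eq_square)
qed

section \<open>Norm and \<open>eps\<close> in terms of coefficients\<close>

locale orthonormal_polynomials =
  fixes w :: "real \<Rightarrow> real" and p :: "nat \<Rightarrow> real poly" and a b :: "nat \<Rightarrow> real"
  assumes w_cont: "continuous_on {-1..1} w"
    and w_nonneg: "\<forall>x\<in>{-1..1}. 0 \<le> w x"
    and p_orth: "\<forall>i j. integral {-1..1} (\<lambda>x. poly (p i) x * poly (p j) x * w x)
                         = (if i = j then 1 else 0)"
    and b_pos: "\<forall>l. b l > 0"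
    and rec: "\<forall>l x. b (l + 1) * poly (p (l + 1)) x
                 = (x - a l) * poly (p l) x - (if l = 0 then 0 else b l * poly (p (l - 1)) x)"
begin

text \<open>The factor \<open>g\<close> is left general so that one expansion serves both the norm
  (\<open>g = 1\<close>) and \<open>eps\<close> (\<open>g x = x\<close>).\<close>

lemma integral_times_cmod_sq:
  assumes g: "continuous_on {-1..1} g"
  shows "integral {-1..1} (\<lambda>x. g x * (cmod (\<Sum>l\<le>n. C l * complex_of_real (poly (p l) x)))\<^sup>2 * w x)
    = (\<Sum>i\<le>n. \<Sum>j\<le>n. Re (C i * cnj (C j)) *
         integral {-1..1} (\<lambda>x. g x * (poly (p i) x * poly (p j) x * w x)))"
proof -
  have sq: "(cmod (\<Sum>l\<le>n. C l * complex_of_real (poly (p l) x)))\<^sup>2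
     = (\<Sum>i\<le>n. \<Sum>j\<le>n. Re (C i * cnj (C j)) * (poly (p i) x * poly (p j) x))" for x
  proof -
    have "(cmod z)\<^sup>2 = Re (z * cnj z)" for z
      by (simp only: cmod_power2) (simp add: power2_eq_square)
    then show ?thesis
      by (simp only: cnj_sum sum_product Re_sum)
        (intro sum.cong refl, simp add: algebra_simps)
  qed
  have int: "(\<lambda>x. r * (g x * (poly (p i) x * poly (p j) x * w x))) integrable_on {-1..1}" for r i j
    by (intro integrable_continuous_interval continuous_intros g w_cont)
  have "integral {-1..1} (\<lambda>x. g x * (cmod (\<Sum>l\<le>n. C l * complex_of_real (poly (p l) x)))\<^sup>2 * w x)
    = integral {-1..1} (\<lambda>x. \<Sum>i\<le>n. \<Sum>j\<le>n. Re (C i * cnj (C j)) *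
          (g x * (poly (p i) x * poly (p j) x * w x)))"
    by (simp only: sq sum_distrib_left sum_distrib_right mult_ac)
  also have "\<dots> = (\<Sum>i\<le>n. \<Sum>j\<le>n. Re (C i * cnj (C j)) *
         integral {-1..1} (\<lambda>x. g x * (poly (p i) x * poly (p j) x * w x)))"
    by (subst integral_sum, simp, intro integrable_sum int, simp,
        intro sum.cong refl, subst integral_sum, simp, rule int, simp)
  finally show ?thesis .
qed

lemma wnorm2_expansion:
  "wnorm2 w (\<lambda>x. \<Sum>l\<le>n. C l * complex_of_real (poly (p l) x)) = (\<Sum>l\<le>n. (cmod (C l))\<^sup>2)"
proof -
  have "wnorm2 w (\<lambda>x. \<Sum>l\<le>n. C l * complex_of_real (poly (p l) x))
    = (\<Sum>i\<le>n. \<Sum>j\<le>n. Re (C i * cnj (C j)) * (if i = j then 1 else 0))"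
    using integral_times_cmod_sq[of "\<lambda>_. 1" C n] p_orth by (simp add: wnorm2_def)
  also have "\<dots> = (\<Sum>i\<le>n. Re (C i * cnj (C i)))"
    by (intro sum.cong refl) (simp add: if_distrib[of "\<lambda>y. _ * y"] cong: if_cong)
  also have "\<dots> = (\<Sum>l\<le>n. (cmod (C l))\<^sup>2)"
    by (intro sum.cong refl) (simp only: cmod_power2, simp add: power2_eq_square)
  finally show ?thesis .
qed

text \<open>The recurrence spreads \<open>x * p i\<close> over three neighbouring degrees and
  orthonormality selects the one equal to \<open>j\<close>; the result is the entry of the Jacobi
  matrix.\<close>

lemma integral_x_times_p_p:
  "integral {-1..1} (\<lambda>x. x * (poly (p i) x * poly (p j) x * w x))
    = (if j = Suc i then b j else if i = Suc j then b i else if i = j then a i else 0)"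
proof -
  have int: "(\<lambda>x. r * (poly (p i) x * poly (p j) x * w x)) integrable_on {-1..1}" for r i j
    by (intro integrable_continuous_interval continuous_intros w_cont)
  \<comment> \<open>At \<open>i = 0\<close> the truncated \<open>i - 1\<close> is again 0, so the
    coefficient itself must vanish there; this encodes that the polynomial of index -1 is
    zero.\<close>
  define b' where "b' = (if i = 0 then 0 else b i)"
  have "x * poly (p i) x = b (Suc i) * poly (p (Suc i)) x + a i * poly (p i) x
      + b' * poly (p (i - 1)) x" for x
    using rec[rule_format, of i x] by (auto simp: b'_def algebra_simps)
  then have "x * (poly (p i) x * poly (p j) x * w x)
    = b (Suc i) * (poly (p (Suc i)) x * poly (p j) x * w x)
      + a i * (poly (p i) x * poly (p j) x * w x)
      + b' * (poly (p (i - 1)) x * poly (p j) x * w x)" for x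
    by (simp only: mult.assoc[symmetric]) (simp add: algebra_simps)
  then have "integral {-1..1} (\<lambda>x. x * (poly (p i) x * poly (p j) x * w x))
    = b (Suc i) * (if Suc i = j then 1 else 0) + a i * (if i = j then 1 else 0)
      + b' * (if i - 1 = j then 1 else 0)"
    by (simp only:) (subst integral_add, (intro integrable_add int)+, subst integral_add,
        (intro int)+, simp add: p_orth)
  then show ?thesis by (cases i) (auto simp: b'_def)
qed

lemma eps_expansion:
  "eps w (\<lambda>x. \<Sum>l\<le>n. C l * complex_of_real (poly (p l) x)) = jacobi_form a b n C"
proof -
  define K where "K i j = (if j = Suc i then b j else if i = Suc j then b i
      else if i = j then a i else 0)" for i j
  have "eps w (\<lambda>x. \<Sum>l\<le>n. C l * complex_of_real (poly (p l) x))
    = (\<Sum>i\<le>n. \<Sum>j\<le>n. Re (C i * cnj (C j)) * K i j)"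
    using integral_times_cmod_sq[of "\<lambda>x. x" C n]
    by (simp add: eps_def integral_x_times_p_p K_def)
  also have "\<dots> = jacobi_form a b n C"
  proof (induction n)
    case 0
    show ?case by (simp add: jacobi_form_def K_def cmod_power2) (simp add: power2_eq_square)
  next
    case (Suc n)
    have diag: "Re (C i * cnj (C i)) = (cmod (C i))\<^sup>2" for i
      by (simp only: cmod_power2) (simp add: power2_eq_square)
    \<comment> \<open>The new row and the new column of the matrix meet the old indices only at
      \<open>n\<close> and contribute equal amounts, whence the factor 2 in
      \<open>jacobi_form\<close>.\<close>
    have row: "(\<Sum>j\<le>n. Re (C (Suc n) * cnj (C j)) * K (Suc n) j)
        = b (Suc n) * Re (C n * cnj (C (Suc n)))"
    proof -
      have "(\<Sum>j\<le>n. Re (C (Suc n) * cnj (C j)) * K (Suc n) j)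
        = (\<Sum>j\<le>n. if j = n then b (Suc n) * Re (C n * cnj (C (Suc n))) else 0)"
        by (intro sum.cong refl) (auto simp: K_def)
      then show ?thesis by simp
    qed
    have col: "(\<Sum>i\<le>n. Re (C i * cnj (C (Suc n))) * K i (Suc n))
        = b (Suc n) * Re (C n * cnj (C (Suc n)))"
    proof -
      have "(\<Sum>i\<le>n. Re (C i * cnj (C (Suc n))) * K i (Suc n))
        = (\<Sum>i\<le>n. if i = n then b (Suc n) * Re (C n * cnj (C (Suc n))) else 0)"
        by (intro sum.cong refl) (auto simp: K_def)
      then show ?thesis by simp
    qed
    have "K (Suc n) (Suc n) = a (Suc n)" by (simp add: K_def)
    then show ?case
      using Suc.IH row col diag
      by (simp only: sum.atMost_Suc sum.distrib jacobi_form_def sum.lessThan_Suc)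
        (simp add: algebra_simps)
  qed
  finally show ?thesis .
qed

text \<open>Follows from \<open>\<bar>x\<bar> \<le> 1\<close> and the sign of \<open>w\<close>. It
  later confines the largest real zero to \<open>[-1,1]\<close>.\<close>

lemma abs_eps_le_wnorm2:
  assumes "continuous_on {-1..1} P"
  shows "\<bar>eps w P\<bar> \<le> wnorm2 w P"
proof -
  have "norm (integral {-1..1} (\<lambda>x. x * (cmod (P x))\<^sup>2 * w x))
      \<le> integral {-1..1} (\<lambda>x. (cmod (P x))\<^sup>2 * w x)"
  proof (rule integral_norm_bound_integral)
    fix x :: real assume x: "x \<in> {-1..1}"
    then have "\<bar>x\<bar> * ((cmod (P x))\<^sup>2 * w x) \<le> 1 * ((cmod (P x))\<^sup>2 * w x)"
      using w_nonneg by (intro mult_right_mono) auto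
    then show "norm (x * (cmod (P x))\<^sup>2 * w x) \<le> (cmod (P x))\<^sup>2 * w x"
      using x w_nonneg by (simp add: abs_mult mult.assoc)
  qed (intro integrable_continuous_interval continuous_intros w_cont assms)+
  then show ?thesis by (simp add: eps_def wnorm2_def)
qed

section \<open>The extremal problem on \<open>Pi_nR\<close>\<close>

context
  fixes m n :: nat and e :: "nat \<Rightarrow> complex" and R :: "real \<Rightarrow> complex" and \<gamma> \<delta> lam :: real
  assumes mn: "m \<le> n"
    and R_def: "R = (\<lambda>x. complex_of_real (poly (p m) x)
                        + (\<Sum>l<m. e l * complex_of_real (poly (p l) x)))"
    and \<gamma>_def: "\<gamma> = eps w R - a m"
    and \<delta>_def: "\<delta> = wnorm2 w R"
    and lam_def: "lam = largest_zero (corec_assoc a b m \<gamma> \<delta> (n - m + 1))"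
begin

private abbreviation q :: "nat \<Rightarrow> real \<Rightarrow> real" where
  "q \<equiv> corec_assoc a b m \<gamma> \<delta>"

text \<open>The full coefficient vector of \<open>R\<close>: \<open>e\<close> is meaningful only
  below \<open>m\<close>, and the coefficient of \<open>p m\<close> is 1.\<close>

private abbreviation E :: "nat \<Rightarrow> complex" where
  "E \<equiv> e(m := 1)"

text \<open>Here \<open>u\<close> records the ratios of the coefficients to the candidate
  coefficients \<open>q j \<mu>\<close>, so that constant \<open>u\<close> means a multiple of the
  candidate.\<close>

definition combination :: "real \<Rightarrow> (nat \<Rightarrow> complex) \<Rightarrow> real \<Rightarrow> complex" where
  "combination \<mu> u = (\<lambda>x. u 0 * R x
     + (\<Sum>l\<in>{m+1..n}. complex_of_real (q (l - m) \<mu>) * u (l - m) * complex_of_real (poly (p l) x)))"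

lemma R_expansion: "R = (\<lambda>x. \<Sum>l\<le>m. E l * complex_of_real (poly (p l) x))"
proof
  fix x
  have "(\<Sum>l\<le>m. E l * complex_of_real (poly (p l) x))
     = E m * complex_of_real (poly (p m) x) + (\<Sum>l<m. E l * complex_of_real (poly (p l) x))"
    by (simp add: lessThan_Suc_atMost[symmetric])
  then show "R x = (\<Sum>l\<le>m. E l * complex_of_real (poly (p l) x))"
    unfolding R_def by simp
qed

lemma gamma_eq: "\<gamma> = jacobi_form a b m E - a m"
  unfolding \<gamma>_def R_expansion eps_expansion ..

lemma delta_eq: "\<delta> = (\<Sum>l\<le>m. (cmod (E l))\<^sup>2)"
  unfolding \<delta>_def R_expansion wnorm2_expansion ..

lemma delta_pos: "\<delta> > 0"
  unfolding delta_eq by (rule sum_pos2[of _ m]) auto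

lemma combination_expansion:
  "combination \<mu> u = (\<lambda>x. \<Sum>l\<le>n. (if l \<le> m then u 0 * E l
      else complex_of_real (q (l - m) \<mu>) * u (l - m)) * complex_of_real (poly (p l) x))"
    (is "_ = (\<lambda>x. \<Sum>l\<le>n. ?C l * _ x l)")
proof
  fix x
  have "{..n} = {..m} \<union> {m+1..n}" using mn by auto
  then have "(\<Sum>l\<le>n. ?C l * complex_of_real (poly (p l) x))
      = (\<Sum>l\<le>m. ?C l * complex_of_real (poly (p l) x))
        + (\<Sum>l\<in>{m+1..n}. ?C l * complex_of_real (poly (p l) x))"
    by (simp only:) (rule sum.union_disjoint, auto)
  also have "\<dots> = combination \<mu> u x"
    unfolding combination_def unfolding R_expansion sum_distrib_left
    by (intro arg_cong2[of _ _ _ _ "(+)"] sum.cong) auto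
  finally show "combination \<mu> u x = (\<Sum>l\<le>n. ?C l * complex_of_real (poly (p l) x))" ..
qed

text \<open>Kept for arbitrary \<open>\<mu>\<close>, because it is applied to the largest real zero
  before that zero is identified with \<open>lam\<close>.\<close>

lemma combination_deficit:
  "\<mu> * wnorm2 w (combination \<mu> u) - eps w (combination \<mu> u)
    = (\<Sum>j<n - m. b (m + j + 1) * q j \<mu> * q (Suc j) \<mu> * (cmod (u j - u (Suc j)))\<^sup>2)
      + b (n + 1) * q (n - m + 1) \<mu> * q (n - m) \<mu> * (cmod (u (n - m)))\<^sup>2"
  using jacobi_form_sum_of_squares[OF b_pos, where E = E and m = m and \<mu> = \<mu>
      and a = a and u = u and k = "n - m"] mn
  unfolding combination_expansion wnorm2_expansion eps_expansion gamma_eq[symmetric] delta_eq[symmetric]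
  by simp

text \<open>\<open>largest_zero\<close> is a maximum over zeros in \<open>[-1,1]\<close> only. The
  largest zero on the whole line is therefore taken first, then shown to lie in the interval, and so
  it is \<open>lam\<close> and inherits the positivity of the lower degrees.\<close>

lemma lam_zero_pos: "q (n - m + 1) lam = 0" "\<forall>j\<le>n - m. q j lam > 0"
proof -
  obtain \<mu> where \<mu>: "q (Suc (n - m)) \<mu> = 0" "\<forall>j\<le>n - m. \<forall>x\<ge>\<mu>. q j x > 0"
      "\<forall>x>\<mu>. q (Suc (n - m)) x > 0"
    using corec_assoc_largest_real_zero[OF b_pos delta_pos] by blast
  have cont: "continuous_on {-1..1} (combination \<mu> (\<lambda>_. 1))"
    unfolding combination_expansion by (intro continuous_intros)
  have pos: "wnorm2 w (combination \<mu> (\<lambda>_. 1)) > 0"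
    unfolding combination_expansion wnorm2_expansion by (rule sum_pos2[of _ m]) (use mn in auto)
  \<comment> \<open>Constant ratios cancel every square, and the zero at \<open>\<mu>\<close>
    cancels the boundary term.\<close>
  have "\<mu> * wnorm2 w (combination \<mu> (\<lambda>_. 1)) = eps w (combination \<mu> (\<lambda>_. 1))"
    using combination_deficit[of \<mu> "\<lambda>_. 1"] \<mu>(1) by simp
  then have "\<bar>\<mu>\<bar> * wnorm2 w (combination \<mu> (\<lambda>_. 1)) \<le> 1 * wnorm2 w (combination \<mu> (\<lambda>_. 1))"
    using abs_eps_le_wnorm2[OF cont] pos by (simp add: abs_mult flip: \<open>_ = eps w _\<close>)
  then have "\<bar>\<mu>\<bar> \<le> 1"
    using pos by (rule mult_right_le_imp_le)
  have "lam = \<mu>" unfolding lam_def largest_zero_def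
  proof (rule Max_eqI)
    show "finite {x \<in> {-1..1}. q (n - m + 1) x = 0}"
      by (rule finite_subset[OF _ finite_zeros_corec_assoc[OF b_pos delta_pos, of a m \<gamma> "n - m + 1"]]) blast
    show "\<mu> \<in> {x \<in> {-1..1}. q (n - m + 1) x = 0}"
      using \<mu>(1) \<open>\<bar>\<mu>\<bar> \<le> 1\<close> by auto
    show "y \<le> \<mu>" if "y \<in> {x \<in> {-1..1}. q (n - m + 1) x = 0}" for y
      using that \<mu>(3)[rule_format, of y] by (cases "\<mu> < y") auto
  qed
  then show "q (n - m + 1) lam = 0" "\<forall>j\<le>n - m. q j lam > 0"
    using \<mu> by auto
qed

definition extremal :: "real \<Rightarrow> complex" where
  "extremal = (\<lambda>x. R x + (\<Sum>l\<in>{m+1..n}. complex_of_real (q (l - m) lam * poly (p l) x)))"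

lemma combination_const: "combination lam (\<lambda>_. \<kappa>) = (\<lambda>x. \<kappa> * extremal x)"
  by (simp add: combination_def extremal_def fun_eq_iff distrib_left sum_distrib_left mult_ac)

lemma Pi_nR_eq: "Pi_nR p R m n = range (combination lam)"
proof
  show "range (combination lam) \<subseteq> Pi_nR p R m n"
  proof clarify
    fix u
    show "combination lam u \<in> Pi_nR p R m n"
      unfolding Pi_nR_def combination_def
      by (intro CollectI exI[of _ "\<lambda>l. complex_of_real (q (l - m) lam) * u (l - m)"]) simp
  qed
  show "Pi_nR p R m n \<subseteq> range (combination lam)"
  proof
    fix P assume "P \<in> Pi_nR p R m n"
    then obtain c where c: "P = (\<lambda>x. c m * R x + (\<Sum>l\<in>{m+1..n}. c l * complex_of_real (poly (p l) x)))"
      unfolding Pi_nR_def by blast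
    \<comment> \<open>Positivity at \<open>lam\<close> allows division by the candidate
      coefficients. Since \<open>q 0 lam = 1\<close>, the ratio at 0 is \<open>c m\<close>
      itself.\<close>
    have "q (l - m) lam \<noteq> 0" if "l \<in> {m+1..n}" for l
      using lam_zero_pos(2)[rule_format, of "l - m"] that by (simp add: diff_le_mono)
    then have "P = combination lam (\<lambda>j. c (m + j) / complex_of_real (q j lam))"
      unfolding c combination_def by (auto simp: fun_eq_iff intro!: sum.cong)
    then show "P \<in> range (combination lam)" by blast
  qed
qed

lemma eps_combination_le: "eps w (combination lam u) \<le> lam * wnorm2 w (combination lam u)"
proof -
  have "0 \<le> (\<Sum>j<n - m. b (m + j + 1) * q j lam * q (Suc j) lam * (cmod (u j - u (Suc j)))\<^sup>2)"
    using lam_zero_pos(2) b_pos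
    by (intro sum_nonneg mult_nonneg_nonneg) (auto simp: less_imp_le)
  then show ?thesis using combination_deficit[of lam u] lam_zero_pos(1) by simp
qed

lemma eps_combination_eq_imp_extremal:
  assumes "eps w (combination lam u) = lam * wnorm2 w (combination lam u)"
  shows "combination lam u = (\<lambda>x. u 0 * extremal x)"
proof -
  have "(\<Sum>j<n - m. b (m + j + 1) * q j lam * q (Suc j) lam * (cmod (u j - u (Suc j)))\<^sup>2) = 0"
    using combination_deficit[of lam u] lam_zero_pos(1) assms by simp
  then have "\<forall>j\<in>{..<n - m}. b (m + j + 1) * q j lam * q (Suc j) lam * (cmod (u j - u (Suc j)))\<^sup>2 = 0"
    using lam_zero_pos(2) b_pos
    by (subst (asm) sum_nonneg_eq_0_iff) (auto intro!: mult_nonneg_nonneg simp: less_imp_le)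
  then have vanish: "b (m + j + 1) * q j lam * q (Suc j) lam * (cmod (u j - u (Suc j)))\<^sup>2 = 0"
    if "j < n - m" for j
    using that by blast
  \<comment> \<open>Both \<open>j\<close> and \<open>Suc j\<close> are at most \<open>n - m\<close>,
    so the weight is strictly positive and the squared difference must vanish.\<close>
  have step: "u (Suc j) = u j" if "j < n - m" for j
  proof -
    have "b (m + j + 1) * q j lam * q (Suc j) lam > 0"
      using that lam_zero_pos(2)[rule_format, of j] lam_zero_pos(2)[rule_format, of "Suc j"] b_pos
      by simp
    then have "(cmod (u j - u (Suc j)))\<^sup>2 = 0"
      using vanish[OF that] mult_eq_0_iff by (metis less_irrefl)
    then show ?thesis by simp
  qed
  have const: "u j = u 0" if "j \<le> n - m" for j
    using that
  proof (induction j)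
    case (Suc j)
    then show ?case using step[of j] by simp
  qed simp
  \<comment> \<open>\<open>combination\<close> reads \<open>u\<close> only at indices up to
    \<open>n - m\<close>, so constancy on that range suffices.\<close>
  have "combination lam u = combination lam (\<lambda>_. u 0)"
  proof
    fix x
    have "u (l - m) = u 0" if "l \<in> {m+1..n}" for l
      using that by (intro const) (simp add: diff_le_mono)
    then show "combination lam u x = combination lam (\<lambda>_. u 0) x"
      unfolding combination_def by (intro arg_cong2[of _ _ _ _ "(+)"] sum.cong refl) simp
  qed
  then show ?thesis by (simp only: combination_const)
qed

lemma eps_extremal: "eps w (\<lambda>x. \<kappa> * extremal x) = lam * wnorm2 w (\<lambda>x. \<kappa> * extremal x)"
  using combination_deficit[of lam "\<lambda>_. \<kappa>"] lam_zero_pos(1) by (simp add: combination_const)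

lemma exists_normalized_extremal: "\<exists>\<kappa>. wnorm2 w (\<lambda>x. \<kappa> * extremal x) = 1"
proof -
  have pos: "wnorm2 w (\<lambda>x. 1 * extremal x) > 0"
    unfolding combination_const[symmetric] combination_expansion wnorm2_expansion
    by (rule sum_pos2[of _ m]) (use mn in auto)
  have "wnorm2 w (\<lambda>x. \<kappa> * extremal x) = (cmod \<kappa>)\<^sup>2 * wnorm2 w extremal" for \<kappa>
    by (simp add: wnorm2_def norm_mult power_mult_distrib mult.assoc)
  from this[of "complex_of_real (1 / sqrt (wnorm2 w extremal))"] pos show ?thesis
    by (intro exI[of _ "complex_of_real (1 / sqrt (wnorm2 w extremal))"])
      (simp add: norm_divide power_divide)
qed

lemma Pi_nR_max_eps:
  shows "\<exists>P\<in>unit_sphere_w w (Pi_nR p R m n). eps w P = lam"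
    and "\<forall>P\<in>unit_sphere_w w (Pi_nR p R m n). eps w P \<le> lam"
proof -
  obtain \<kappa> where "wnorm2 w (\<lambda>x. \<kappa> * extremal x) = 1" using exists_normalized_extremal by blast
  moreover have "(\<lambda>x. \<kappa> * extremal x) \<in> Pi_nR p R m n"
    unfolding Pi_nR_eq combination_const[symmetric] by blast
  ultimately show "\<exists>P\<in>unit_sphere_w w (Pi_nR p R m n). eps w P = lam"
    using eps_extremal[of \<kappa>] unfolding unit_sphere_w_def by auto
  show "\<forall>P\<in>unit_sphere_w w (Pi_nR p R m n). eps w P \<le> lam"
  proof
    fix P assume "P \<in> unit_sphere_w w (Pi_nR p R m n)"
    then obtain u where "P = combination lam u" "wnorm2 w P = 1"
      unfolding unit_sphere_w_def Pi_nR_eq by auto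
    then show "eps w P \<le> lam" using eps_combination_le[of u] by simp
  qed
qed

lemma sphere_maximizers:
  "maximizers w (unit_sphere_w w (Pi_nR p R m n))
    = {P. \<exists>\<kappa>. P = (\<lambda>x. \<kappa> * extremal x) \<and> sqrt (wnorm2 w P) = 1}"
proof -
  \<comment> \<open>As \<open>lam\<close> is an attained upper bound, being a maximizer amounts to
    reaching the value \<open>lam\<close>.\<close>
  have "maximizers w (unit_sphere_w w (Pi_nR p R m n))
      = {P \<in> unit_sphere_w w (Pi_nR p R m n). eps w P = lam}"
    unfolding maximizers_def using Pi_nR_max_eps by (auto intro: order_antisym)
  also have "\<dots> = {P. \<exists>\<kappa>. P = (\<lambda>x. \<kappa> * extremal x) \<and> sqrt (wnorm2 w P) = 1}"
  proof (intro equalityI subsetI)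
    fix P assume P: "P \<in> {P \<in> unit_sphere_w w (Pi_nR p R m n). eps w P = lam}"
    then obtain u where u: "P = combination lam u" "sqrt (wnorm2 w P) = 1"
      unfolding unit_sphere_w_def Pi_nR_eq by blast
    then have "P = (\<lambda>x. u 0 * extremal x)"
      using P eps_combination_eq_imp_extremal[of u] by simp
    with u show "P \<in> {P. \<exists>\<kappa>. P = (\<lambda>x. \<kappa> * extremal x) \<and> sqrt (wnorm2 w P) = 1}" by blast
  next
    fix P assume "P \<in> {P. \<exists>\<kappa>. P = (\<lambda>x. \<kappa> * extremal x) \<and> sqrt (wnorm2 w P) = 1}"
    then obtain \<kappa> where \<kappa>: "P = (\<lambda>x. \<kappa> * extremal x)" "sqrt (wnorm2 w P) = 1" by blast
    moreover have "P \<in> Pi_nR p R m n"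
      unfolding Pi_nR_eq \<kappa>(1) combination_const[symmetric] by blast
    ultimately show "P \<in> {P \<in> unit_sphere_w w (Pi_nR p R m n). eps w P = lam}"
      using eps_extremal[of \<kappa>] by (simp add: unit_sphere_w_def)
  qed
  finally show ?thesis .
qed

lemma Pi_nR_maximizers:
  "maximizers w (unit_sphere_w w (Pi_nR p R m n))
    = {P. \<exists>\<kappa>::complex. P = (\<lambda>x. \<kappa> * (R x + (\<Sum>l\<in>{m+1..n}.
            complex_of_real (q (l - m) lam * poly (p l) x)))) \<and> sqrt (wnorm2 w P) = 1}"
  using sphere_maximizers unfolding extremal_def .

end

section \<open>The spaces \<open>Pi_nm\<close> and \<open>Pi_n\<close> as special cases\<close>

text \<open>For \<open>R = p m\<close>, orthonormality and the recurrence give norm 1 and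
  \<open>eps w R = a m\<close>. Hence the shift is 0 and the scaling 1, which turns
  \<open>corec_assoc\<close> into \<open>assoc_poly\<close>, and \<open>R\<close> becomes the
  summand \<open>l = m\<close>.\<close>

lemma Pi_nm_maximizers:
  assumes mn: "m \<le> n" and lam: "lam = largest_zero (assoc_poly a b m (n - m + 1))"
  shows "maximizers w (unit_sphere_w w (Pi_nm p m n)) =
      {P. \<exists>\<kappa>::complex. P = (\<lambda>x. \<kappa> * (\<Sum>l\<in>{m..n}.
            complex_of_real (assoc_poly a b m (l - m) lam * poly (p l) x)))
          \<and> sqrt (wnorm2 w P) = 1}"
    and "\<exists>P\<in>unit_sphere_w w (Pi_nm p m n). eps w P = lam"
    and "\<forall>P\<in>unit_sphere_w w (Pi_nm p m n). eps w P \<le> lam"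
proof -
  \<comment> \<open>The zero summands give \<open>R\<close> the shape that the general case
    expects.\<close>
  define R where "R = (\<lambda>x. complex_of_real (poly (p m) x)
      + (\<Sum>l<m. 0 * complex_of_real (poly (p l) x)))"
  have R: "R x = complex_of_real (poly (p m) x)" for x by (simp add: R_def)
  let ?E = "(\<lambda>_. 0)(m := 1 :: complex)"
  have Rexp: "R = (\<lambda>x. \<Sum>l\<le>m. ?E l * complex_of_real (poly (p l) x))"
    by (simp add: R fun_eq_iff if_distrib[of "\<lambda>y. y * _"] cong: if_cong)
  have *: "(cmod (?E l))\<^sup>2 = (if l = m then 1 else 0)" for l by simp
  have "(\<Sum>l<m. b (l + 1) * Re (?E l * cnj (?E (Suc l)))) = 0"
    by (intro sum.neutral) simp
  then have "jacobi_form a b m ?E = a m"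
    unfolding jacobi_form_def * by (simp add: if_distrib[of "\<lambda>y. _ * y"] cong: if_cong)
  moreover have "eps w R = jacobi_form a b m ?E" unfolding Rexp by (rule eps_expansion)
  ultimately have \<gamma>: "0 = eps w R - a m" by linarith
  have \<delta>: "1 = wnorm2 w R" unfolding Rexp wnorm2_expansion * by simp
  have assoc: "corec_assoc a b m 0 1 l x = assoc_poly a b m l x" for l x
    by (induction a b m l x rule: assoc_poly.induct) auto
  have lam': "lam = largest_zero (corec_assoc a b m 0 1 (n - m + 1))"
    unfolding lam by (rule arg_cong[of _ _ largest_zero]) (simp add: assoc fun_eq_iff)
  have head: "(\<Sum>l\<in>{m..n}. f l) = f m + (\<Sum>l\<in>{m+1..n}. f l)" for f :: "nat \<Rightarrow> complex"
    using mn by (simp add: sum.atLeast_Suc_atMost)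
  have space: "Pi_nR p R m n = Pi_nm p m n"
    unfolding Pi_nR_def Pi_nm_def head R ..
  have ext: "R x + (\<Sum>l\<in>{m+1..n}. complex_of_real (corec_assoc a b m 0 1 (l - m) lam * poly (p l) x))
      = (\<Sum>l\<in>{m..n}. complex_of_real (assoc_poly a b m (l - m) lam * poly (p l) x))" for x
    unfolding head R assoc by simp
  show "maximizers w (unit_sphere_w w (Pi_nm p m n)) =
      {P. \<exists>\<kappa>::complex. P = (\<lambda>x. \<kappa> * (\<Sum>l\<in>{m..n}.
            complex_of_real (assoc_poly a b m (l - m) lam * poly (p l) x)))
          \<and> sqrt (wnorm2 w P) = 1}"
    using Pi_nR_maximizers[OF mn R_def \<gamma> \<delta> lam'] unfolding space ext .
  show "\<exists>P\<in>unit_sphere_w w (Pi_nm p m n). eps w P = lam"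
    and "\<forall>P\<in>unit_sphere_w w (Pi_nm p m n). eps w P \<le> lam"
    using Pi_nR_max_eps[OF mn R_def \<gamma> \<delta> lam'] unfolding space by blast+
qed

text \<open>For \<open>m = 0\<close> both families obey the same recurrence; only the starting
  values \<open>1 / b 0\<close> and 1 differ.\<close>

lemma poly_p_eq_assoc_poly:
  assumes p0: "p 0 = [:1 / b 0:]"
  shows "poly (p l) x = assoc_poly a b 0 l x / b 0"
proof (induction l rule: less_induct)
  case (less l)
  consider "l = 0" | "l = Suc 0" | k where "l = Suc (Suc k)"
    by (metis not0_implies_Suc)
  then show ?case
  proof cases
    case 1
    then show ?thesis by (simp add: p0)
  next
    case 2
    then show ?thesis
      using rec[rule_format, of 0 x] b_pos[rule_format, of 0] b_pos[rule_format, of 1]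
      by (simp add: p0 field_simps)
  next
    case 3
    have "b (k + 2) * poly (p l) x = (x - a (k + 1)) * poly (p (Suc k)) x - b (k + 1) * poly (p k) x"
      using rec[rule_format, of "Suc k" x] 3 by simp
    then have "poly (p l) x
        = ((x - a (k + 1)) * poly (p (Suc k)) x - b (k + 1) * poly (p k) x) / b (k + 2)"
      using b_pos[rule_format, of "k + 2"] by (simp add: field_simps)
    then show ?thesis using less[of k] less[of "Suc k"] 3
      by (simp add: diff_divide_distrib mult.commute)
  qed
qed

lemma Pi_n_maximizers:
  assumes p0: "p 0 = [:1 / b 0:]" and lam: "lam = largest_zero (\<lambda>x. poly (p (n + 1)) x)"
  shows "maximizers w (unit_sphere_w w (Pi_n p n)) =
      {P. \<exists>\<kappa>::complex. P = (\<lambda>x. \<kappa> * (\<Sum>l\<le>n. complex_of_real (poly (p l) lam * poly (p l) x)))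
          \<and> sqrt (wnorm2 w P) = 1}"
    and "\<exists>P\<in>unit_sphere_w w (Pi_n p n). eps w P = lam"
    and "\<forall>P\<in>unit_sphere_w w (Pi_n p n). eps w P \<le> lam"
proof -
  have b0: "b 0 \<noteq> 0" using b_pos by (metis less_irrefl)
  \<comment> \<open>Division by the nonzero constant \<open>b 0\<close> does not move zeros.\<close>
  have lam': "lam = largest_zero (assoc_poly a b 0 (n - 0 + 1))"
    unfolding lam largest_zero_def poly_p_eq_assoc_poly[OF p0] using b0 by simp
  have space: "Pi_nm p 0 n = Pi_n p n"
    by (simp add: Pi_nm_def Pi_n_def atLeast0AtMost)
  define S where "S x = (\<Sum>l\<in>{0..n}. complex_of_real (assoc_poly a b 0 (l - 0) lam * poly (p l) x))" for x
  have ext: "(\<Sum>l\<le>n. complex_of_real (poly (p l) lam * poly (p l) x)) = S x / complex_of_real (b 0)" for x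
    unfolding S_def atLeast0AtMost sum_divide_distrib
    by (intro sum.cong refl) (simp add: poly_p_eq_assoc_poly[OF p0, of _ lam])
  \<comment> \<open>The constant \<open>b 0\<close> between the two forms of the extremal polynomial
    is absorbed into the free scalar; the normalization concerns \<open>P\<close> alone and is
    unaffected.\<close>
  have "(\<exists>\<kappa>. P = (\<lambda>x. \<kappa> * S x)) \<longleftrightarrow> (\<exists>\<kappa>. P = (\<lambda>x. \<kappa> * (S x / complex_of_real (b 0))))" for P
  proof
    assume "\<exists>\<kappa>. P = (\<lambda>x. \<kappa> * S x)"
    then obtain \<kappa> where "P = (\<lambda>x. \<kappa> * S x)" by blast
    then show "\<exists>\<kappa>. P = (\<lambda>x. \<kappa> * (S x / complex_of_real (b 0)))"
      using b0 by (intro exI[of _ "\<kappa> * complex_of_real (b 0)"]) simp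
  next
    assume "\<exists>\<kappa>. P = (\<lambda>x. \<kappa> * (S x / complex_of_real (b 0)))"
    then obtain \<kappa> where "P = (\<lambda>x. \<kappa> * (S x / complex_of_real (b 0)))" by blast
    then show "\<exists>\<kappa>. P = (\<lambda>x. \<kappa> * S x)"
      by (intro exI[of _ "\<kappa> / complex_of_real (b 0)"]) simp
  qed
  then have "{P. \<exists>\<kappa>. P = (\<lambda>x. \<kappa> * S x) \<and> sqrt (wnorm2 w P) = 1}
      = {P. \<exists>\<kappa>. P = (\<lambda>x. \<kappa> * (S x / complex_of_real (b 0))) \<and> sqrt (wnorm2 w P) = 1}"
    by blast
  then show "maximizers w (unit_sphere_w w (Pi_n p n)) =
      {P. \<exists>\<kappa>::complex. P = (\<lambda>x. \<kappa> * (\<Sum>l\<le>n. complex_of_real (poly (p l) lam * poly (p l) x)))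
          \<and> sqrt (wnorm2 w P) = 1}"
    using Pi_nm_maximizers(1)[OF le0 lam'] unfolding space ext S_def[symmetric] by simp
  show "\<exists>P\<in>unit_sphere_w w (Pi_n p n). eps w P = lam"
    and "\<forall>P\<in>unit_sphere_w w (Pi_n p n). eps w P \<le> lam"
    using Pi_nm_maximizers(2,3)[OF le0 lam'] unfolding space by blast+
qed

end

theorem theorem2p8:
  fixes w :: "real \<Rightarrow> real" and p :: "nat \<Rightarrow> real poly"
    and a b :: "nat \<Rightarrow> real" and e :: "nat \<Rightarrow> complex" and m n :: nat
    and R :: "real \<Rightarrow> complex" and \<gamma>R \<delta>R lam lamm lamR :: real
  assumes w_cont: "continuous_on {-1..1} w"
    and w_nonneg: "\<forall>x\<in>{-1..1}. 0 \<le> w x"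
    and p_deg: "\<forall>l. degree (p l) = l"
    and p_lead: "\<forall>l. lead_coeff (p l) > 0"
    and p_orth: "\<forall>i j. integral {-1..1} (\<lambda>x. poly (p i) x * poly (p j) x * w x)
                         = (if i = j then 1 else 0)"
    and b_pos: "\<forall>l. b l > 0"
    and p0: "p 0 = [:1 / b 0:]"
    and rec: "\<forall>l x. b (l + 1) * poly (p (l + 1)) x
                 = (x - a l) * poly (p l) x - (if l = 0 then 0 else b l * poly (p (l - 1)) x)"
    and mn: "m \<le> n"
    and R_def: "R = (\<lambda>x. complex_of_real (poly (p m) x)
                        + (\<Sum>l<m. e l * complex_of_real (poly (p l) x)))"
    and \<gamma>R_def: "\<gamma>R = eps w R - a m"
    and \<delta>R_def: "\<delta>R = wnorm2 w R"
    and lam_def: "lam = largest_zero (\<lambda>x. poly (p (n + 1)) x)"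
    and lamm_def: "lamm = largest_zero (assoc_poly a b m (n - m + 1))"
    and lamR_def: "lamR = largest_zero (corec_assoc a b m \<gamma>R \<delta>R (n - m + 1))"
  shows
   "maximizers w (unit_sphere_w w (Pi_n p n)) =
      {P. \<exists>\<kappa>::complex. P = (\<lambda>x. \<kappa> * (\<Sum>l\<le>n. complex_of_real (poly (p l) lam * poly (p l) x)))
                        \<and> sqrt (wnorm2 w P) = 1}
    \<and> (\<exists>P\<in>unit_sphere_w w (Pi_n p n). eps w P = lam)
    \<and> (\<forall>P\<in>unit_sphere_w w (Pi_n p n). eps w P \<le> lam)
    \<and> maximizers w (unit_sphere_w w (Pi_nm p m n)) =
      {P. \<exists>\<kappa>::complex. P = (\<lambda>x. \<kappa> * (\<Sum>l\<in>{m..n}.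
                          complex_of_real (assoc_poly a b m (l - m) lamm * poly (p l) x)))
                        \<and> sqrt (wnorm2 w P) = 1}
    \<and> (\<exists>P\<in>unit_sphere_w w (Pi_nm p m n). eps w P = lamm)
    \<and> (\<forall>P\<in>unit_sphere_w w (Pi_nm p m n). eps w P \<le> lamm)
    \<and> maximizers w (unit_sphere_w w (Pi_nR p R m n)) =
      {P. \<exists>\<kappa>::complex. P = (\<lambda>x. \<kappa> * (R x + (\<Sum>l\<in>{m+1..n}.
                          complex_of_real (corec_assoc a b m \<gamma>R \<delta>R (l - m) lamR * poly (p l) x))))
                        \<and> sqrt (wnorm2 w P) = 1}
    \<and> (\<exists>P\<in>unit_sphere_w w (Pi_nR p R m n). eps w P = lamR)
    \<and> (\<forall>P\<in>unit_sphere_w w (Pi_nR p R m n). eps w P \<le> lamR)"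
proof -
  interpret orthonormal_polynomials w p a b
    using w_cont w_nonneg p_orth b_pos rec by unfold_locales
  note partR = mn R_def \<gamma>R_def \<delta>R_def lamR_def
  show ?thesis
    by (intro conjI Pi_n_maximizers[OF p0 lam_def] Pi_nm_maximizers[OF mn lamm_def]
        Pi_nR_maximizers[OF partR] Pi_nR_max_eps[OF partR])
qed

end
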